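(* Let $\mathscr{F}(r)=\int_0^1 t^{r-1/2}\sqrt{1+t}\,\arcsin t\,\mathrm{d}t$ for nonnegative integers $r$. For every integer $r\ge 3$, $$\sum_{n=1}^{\infty}\frac{1}{4^n n(n+3/2)}\frac{\binom{4n+2r}{2n+r}}{\binom{2n}{n}}=\frac{4}{9}\binom{2r}{r}+\frac{128}{3}\binom{2r-4}{r-2}-\frac{4^{r+1}}{3\pi}\mathscr{F}(r-1)-\frac{2\cdot 4^{r+1}}{3\pi}\mathscr{F}(r-3),$$ where, for every nonnegative integer $s$, $$\mathscr{F}(s)=\frac{(-1)^s}{4^s}\frac{\binom{2s}{s}}{s+1}\left(\mathscr{F}(0)+\frac{1}{2}\sum_{k=1}^s\frac{(-1)^k4^k}{\binom{2k}{k}}\,\omega_k\right),\qquad \omega_k=2\sqrt{2}\pi-2B(k+3/2,1/2)-2B(k+1/2,1/2).$$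
   Context: $B(u,v)=\int_0^1 t^{u-1}(1-t)^{v-1}\,\mathrm{d}t$ denotes the Beta function. *)

theory Defs
  imports "HOL-Analysis.Analysis"
begin

text \<open>The integral F(r) = int_0^1 t^(r-1/2) sqrt(1+t) arcsin t dt (an absolutely
  convergent, possibly improper at 0 for r = 0, integral; taken as the
  Henstock-Kurzweil / Lebesgue integral over [0,1]).\<close>
definition scrF :: "nat \<Rightarrow> real" where
  "scrF r = integral {0..1} (\<lambda>t::real. t powr (real r - 1/2) * sqrt (1 + t) * arcsin t)"

definition omega :: "nat \<Rightarrow> real" where
  "omega k = 2 * sqrt 2 * pi - 2 * Beta (real k + 3/2) (1/2) - 2 * Beta (real k + 1/2) (1/2)"

end

theory Submission
  imports Defs
begin

text \<open>
  Since \<open>binom(2m, m) / 4^m = B(m + 1/2, 1/2) / \<pi>\<close>, the series is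
  \<open>4^r / \<pi>\<close> times the integral over \<open>[0, 1]\<close> of \<open>t^(r - 1/2) (1 - t)^(-1/2) G(t)\<close>, where
  \<open>G(t) = \<Sum>n\<ge>1. (2t)^(2n) / (n (n + 3/2) binom(2n, n))\<close>. From
  \<open>(t^3 G)' = 4 t^3 arcsin t / sqrt (1 - t^2)\<close> one gets
  \<open>t^3 G = 4 (t^3 / 9 + 2t / 3 - (t^2 + 2) / 3 * sqrt (1 - t^2) arcsin t)\<close>, and the three groups
  of terms integrate to Beta values and to \<open>scrF\<close>. Integrating the derivative of
  \<open>2 t^(s - 1/2) (1 + t)^(3/2) arcsin t\<close> gives \<open>(2s + 2) scrF s + (2s - 1) scrF (s - 1) = omega s\<close>,
  whose solution is the closed form.
\<close>

section \<open>Central binomial coefficients as Beta values\<close>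

definition cbinom_inv :: "nat \<Rightarrow> real" where
  "cbinom_inv n = 4 ^ n / real ((2 * n) choose n)"

lemma cbinom_inv_pos: "cbinom_inv n > 0"
  by (simp add: cbinom_inv_def)

text \<open>Absorption in rows 2n+2 and 2n+1, linked by the symmetry of row 2n+1.\<close>

lemma central_binomial_Suc:
  "real (n + 1) * real ((2 * Suc n) choose (Suc n)) = 2 * (2 * real n + 1) * real ((2 * n) choose n)"
proof -
  have 1: "Suc n * (Suc (2 * n + 1) choose Suc n) = Suc (2 * n + 1) * ((2 * n + 1) choose n)"
    by (rule Suc_times_binomial)
  have 2: "Suc n * (Suc (2 * n) choose Suc n) = Suc (2 * n) * ((2 * n) choose n)"
    by (rule Suc_times_binomial)
  have 3: "(2 * n + 1) choose n = Suc (2 * n) choose Suc n"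
    using binomial_symmetric[of n "2 * n + 1"] by simp
  have "(n + 1) * ((2 * Suc n) choose Suc n) = 2 * (Suc n * (Suc (2 * n) choose Suc n))"
    using 1 3 by simp
  also have "\<dots> = 2 * ((2 * n + 1) * ((2 * n) choose n))"
    using 2 by simp
  finally have "real ((n + 1) * ((2 * Suc n) choose Suc n))
      = real (2 * ((2 * n + 1) * ((2 * n) choose n)))"
    by (rule arg_cong)
  then show ?thesis by (simp add: algebra_simps)
qed

lemma cbinom_inv_Suc:
  "cbinom_inv (Suc n) = cbinom_inv n * (2 * real n + 2) / (2 * real n + 1)"
proof -
  define C D E where "C = real ((2 * n) choose n)" and "D = 2 * real n + 1" and "E = real n + 1"
  have pos: "C > 0" "D > 0" "E > 0" by (auto simp: C_def D_def E_def)
  have "real ((2 * Suc n) choose (Suc n)) = 2 * D * C / E"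
    using central_binomial_Suc[of n] unfolding C_def D_def E_def
    by (simp add: field_simps del: mult_Suc_right binomial_Suc_Suc)
  then have "cbinom_inv (Suc n) = 4 * 4 ^ n / (2 * D * C / E)"
    by (simp add: cbinom_inv_def del: mult_Suc_right binomial_Suc_Suc)
  also have "\<dots> = 4 ^ n / C * (2 * E) / D"
    using pos by (simp add: field_simps)
  finally show ?thesis by (simp add: cbinom_inv_def C_def D_def E_def)
qed

text \<open>A crude bound (the true growth is of order sqrt n), sufficient because it only has to
  lose against \<open>t ^ (2 * N)\<close> with t < 1.\<close>

lemma cbinom_inv_le: "cbinom_inv n \<le> 2 * real n + 1"
proof (induction n)
  case (Suc n)
  have "cbinom_inv (Suc n) \<le> (2 * real n + 1) * (2 * real n + 2) / (2 * real n + 1)"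
    unfolding cbinom_inv_Suc by (intro divide_right_mono mult_right_mono Suc) auto
  then show ?case by simp
qed (simp add: cbinom_inv_def)

text \<open>B(1/2, 1/2) = pi, and raising the first argument by 1 multiplies the Beta value by (m +
  1/2) / (m + 1), the inverse of the ratio in \<open>cbinom_inv_Suc\<close>.\<close>

lemma Beta_nat_half: "Beta (real m + 1/2) (1/2) = pi / cbinom_inv m"
proof (induction m)
  case 0
  show ?case by (simp add: Beta_def Gamma_one_half_real cbinom_inv_def)
next
  case (Suc m)
  have "(real m + 1) * Beta (real (Suc m) + 1/2) (1/2) = (real m + 1/2) * Beta (real m + 1/2) (1/2)"
    using Beta_plus1_left[of "real m + 1/2" "1/2"] by (simp add: add_ac nonpos_Ints_def)
  then have "Beta (real (Suc m) + 1/2) (1/2) = (real m + 1/2) / (real m + 1) * Beta (real m + 1/2) (1/2)"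
    by (simp add: field_simps)
  also have "\<dots> = pi / cbinom_inv (Suc m)"
    using cbinom_inv_pos[of m] unfolding Suc cbinom_inv_Suc by (simp add: field_simps)
  finally show ?case .
qed

lemma Beta_nat_half_has_integral:
  "((\<lambda>t. t powr (real m - 1/2) * (1 - t) powr (-1/2)) has_integral pi / cbinom_inv m) {0..1}"
  using has_integral_Beta_real[of "real m + 1/2" "1/2"] by (simp add: Beta_nat_half)

subsection \<open>Partial sums of the arcsine series\<close>

text \<open>The coefficients equal 4^n n!^2 / (2n+1)!, those of arcsin t / sqrt (1 - t^2).\<close>

definition arcsin_sum :: "nat \<Rightarrow> real \<Rightarrow> real" where
  "arcsin_sum N t = (\<Sum>n<N. cbinom_inv n / (2 * real n + 1) * t ^ (2 * n + 1))"

lemma arcsin_sum_deriv: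
  "(arcsin_sum N has_real_derivative (\<Sum>n<N. cbinom_inv n * t ^ (2 * n))) (at t)"
  unfolding arcsin_sum_def
  by (rule derivative_eq_intros sum.cong refl | simp add: field_simps)+

text \<open>The function \<open>y = arcsin t / sqrt (1 - t\<^sup>2)\<close> solves \<open>(1 - t\<^sup>2) y' - t y = 1\<close>; its Taylor
  polynomials solve the same equation up to a single monomial.\<close>

lemma arcsin_sum_ode:
  "(1 - t\<^sup>2) * (\<Sum>n<N. cbinom_inv n * t ^ (2 * n)) - t * arcsin_sum N t
     = 1 - cbinom_inv N * t ^ (2 * N)"
proof (induction N)
  case 0
  show ?case by (simp add: arcsin_sum_def cbinom_inv_def)
next
  case (Suc N)
  have "(1 - t\<^sup>2) * (\<Sum>n<Suc N. cbinom_inv n * t ^ (2 * n)) - t * arcsin_sum (Suc N) t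
     = 1 - cbinom_inv N * t ^ (2 * N) + (1 - t\<^sup>2) * (cbinom_inv N * t ^ (2 * N))
        - t * (cbinom_inv N / (2 * real N + 1) * t ^ (2 * N + 1))"
    unfolding Suc.IH[symmetric] by (simp add: arcsin_sum_def algebra_simps)
  \<comment> \<open>The t^(2N) terms cancel; those in t^(2N+2) combine through 1 + 1/(2N+1) =
    (2N+2)/(2N+1), the ratio of consecutive \<open>cbinom_inv\<close>.\<close>
  also have "\<dots> = 1 - cbinom_inv (Suc N) * t ^ (2 * Suc N)"
    unfolding cbinom_inv_Suc by (simp add: field_simps power2_eq_square)
  finally show ?case .
qed

text \<open>The factor sqrt (1 - x^2) is an integrating factor for the equation in
  \<open>arcsin_sum_ode\<close>, so only its monomial defect survives, and that has a fixed
  sign.\<close>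

lemma arcsin_remainder_deriv:
  assumes "\<bar>x\<bar> < 1"
  shows "((\<lambda>x. arcsin x - sqrt (1 - x\<^sup>2) * arcsin_sum N x) has_real_derivative
           cbinom_inv N * x ^ (2 * N) / sqrt (1 - x\<^sup>2)) (at x)"
proof -
  have pos: "1 - x\<^sup>2 > 0" using assms by (simp add: abs_square_less_1)
  define s where "s = sqrt (1 - x\<^sup>2)"
  have s: "s > 0" "s * s = 1 - x\<^sup>2" using pos by (auto simp: s_def)
  define D where "D = (\<Sum>n<N. cbinom_inv n * x ^ (2 * n))"
  have "((\<lambda>x. arcsin x - sqrt (1 - x\<^sup>2) * arcsin_sum N x) has_real_derivative
      1 / s - (s * D + - x / s * arcsin_sum N x)) (at x)"
    unfolding s_def D_def using assms pos
    by (auto intro!: derivative_eq_intros arcsin_sum_deriv simp: field_simps)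
  also have "1 / s - (s * D + - x / s * arcsin_sum N x)
      = (1 - ((s * s) * D - x * arcsin_sum N x)) / s"
    using s(1) by (simp add: field_simps)
  also have "\<dots> = cbinom_inv N * x ^ (2 * N) / s"
    unfolding s(2) D_def arcsin_sum_ode by simp
  finally show ?thesis by (simp add: s_def)
qed

text \<open>The remainder vanishes at 0 and has nonnegative derivative. Replacing x^(2N) by the
  constant t^(2N) in that derivative leaves a multiple of arcsin', which gives the upper
  bound.\<close>

lemma arcsin_remainder_bounds:
  assumes "0 \<le> t" "t < 1"
  shows "0 \<le> arcsin t - sqrt (1 - t\<^sup>2) * arcsin_sum N t"
    and "arcsin t - sqrt (1 - t\<^sup>2) * arcsin_sum N t \<le> cbinom_inv N * t ^ (2 * N) * arcsin t"
proof -
  let ?u = "\<lambda>x. arcsin x - sqrt (1 - x\<^sup>2) * arcsin_sum N x"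
  have pos: "1 - x\<^sup>2 > 0" if "0 \<le> x" "x \<le> t" for x
    using that assms by (simp add: abs_square_less_1)
  have "?u 0 \<le> ?u t"
  proof (rule DERIV_nonneg_imp_nondecreasing[OF assms(1)])
    fix x assume x: "0 \<le> x" "x \<le> t"
    show "\<exists>y. (?u has_real_derivative y) (at x) \<and> 0 \<le> y"
      using x assms pos[OF x] cbinom_inv_pos[of N]
      by (intro exI[of _ "cbinom_inv N * x ^ (2 * N) / sqrt (1 - x\<^sup>2)"] conjI arcsin_remainder_deriv)
         auto
  qed
  then show "0 \<le> ?u t" by (simp add: arcsin_sum_def)
  let ?v = "\<lambda>x. cbinom_inv N * t ^ (2 * N) * arcsin x - ?u x"
  have "?v 0 \<le> ?v t"
  proof (rule DERIV_nonneg_imp_nondecreasing[OF assms(1)])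
    fix x assume x: "0 \<le> x" "x \<le> t"
    let ?y = "cbinom_inv N * t ^ (2 * N) * inverse (sqrt (1 - x\<^sup>2))
                - cbinom_inv N * x ^ (2 * N) / sqrt (1 - x\<^sup>2)"
    have "(?v has_real_derivative ?y) (at x)"
      using x assms by (intro DERIV_diff DERIV_cmult DERIV_arcsin arcsin_remainder_deriv) auto
    moreover have "?y \<ge> 0"
    proof -
      have "cbinom_inv N * x ^ (2 * N) / sqrt (1 - x\<^sup>2) \<le> cbinom_inv N * t ^ (2 * N) / sqrt (1 - x\<^sup>2)"
        using x cbinom_inv_pos[of N] pos[OF x]
        by (intro divide_right_mono mult_left_mono power_mono) auto
      then show ?thesis by (simp add: divide_inverse)
    qed
    ultimately show "\<exists>y. (?v has_real_derivative y) (at x) \<and> 0 \<le> y" by blast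
  qed
  then show "?u t \<le> cbinom_inv N * t ^ (2 * N) * arcsin t" by (simp add: arcsin_sum_def)
qed

subsection \<open>The generating function\<close>

definition gf_sum :: "nat \<Rightarrow> real \<Rightarrow> real" where
  "gf_sum N t = (\<Sum>m<N. cbinom_inv (Suc m) / (real (Suc m) * (real (Suc m) + 3/2)) * t ^ (2 * Suc m))"

text \<open>Closed form of t^3 G(t) for 0 < t < 1. With the factor t^3 kept, it vanishes at 0, where
  the comparisons of derivatives start.\<close>

definition gf_cubed :: "real \<Rightarrow> real" where
  "gf_cubed t = 4 * (t ^ 3 / 9 + 2 * t / 3 - (t\<^sup>2 + 2) / 3 * sqrt (1 - t\<^sup>2) * arcsin t)"

text \<open>The factor t^3 makes the exponent 2n + 3, so differentiation cancels n + 3/2; the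
  remaining 1/n, with n = m + 1, is absorbed by \<open>cbinom_inv_Suc\<close>.\<close>

lemma gf_sum_deriv:
  "((\<lambda>t. t ^ 3 * gf_sum N t) has_real_derivative 4 * t ^ 3 * arcsin_sum N t) (at t)"
proof -
  have "(\<lambda>t. t ^ 3 * gf_sum N t)
     = (\<lambda>t. \<Sum>m<N. cbinom_inv (Suc m) / (real (Suc m) * (real (Suc m) + 3/2)) * t ^ (2 * m + 5))"
    by (simp add: gf_sum_def sum_distrib_left fun_eq_iff power_add eval_nat_numeral mult_ac)
  moreover have "((\<lambda>t. cbinom_inv (Suc m) / (real (Suc m) * (real (Suc m) + 3/2)) * t ^ (2 * m + 5))
       has_real_derivative 4 * t ^ 3 * (cbinom_inv m / (2 * real m + 1) * t ^ (2 * m + 1))) (at t)" for m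
  proof -
    have "((\<lambda>t. cbinom_inv (Suc m) / (real (Suc m) * (real (Suc m) + 3/2)) * t ^ (2 * m + 5))
       has_real_derivative cbinom_inv (Suc m) / (real (Suc m) * (real (Suc m) + 3/2))
           * (real (2 * m + 5) * t ^ (2 * m + 4))) (at t)"
      by (rule derivative_eq_intros refl | simp add: add.commute)+
    also have "cbinom_inv (Suc m) / (real (Suc m) * (real (Suc m) + 3/2)) * real (2 * m + 5)
        = 4 * (cbinom_inv m / (2 * real m + 1))"
      unfolding cbinom_inv_Suc by (simp add: divide_simps) (simp add: algebra_simps)
    then have "cbinom_inv (Suc m) / (real (Suc m) * (real (Suc m) + 3/2))
           * (real (2 * m + 5) * t ^ (2 * m + 4))
         = 4 * t ^ 3 * (cbinom_inv m / (2 * real m + 1) * t ^ (2 * m + 1))"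
      by (simp add: mult.assoc[symmetric] power_add eval_nat_numeral)
    finally show ?thesis .
  qed
  ultimately show ?thesis
    by (auto simp: arcsin_sum_def sum_distrib_left intro!: DERIV_sum)
qed

text \<open>The terms free of arcsin cancel, and x(x^2 + 2) - 2x(1 - x^2) = 3x^3.\<close>

lemma gf_cubed_deriv:
  assumes "\<bar>x\<bar> < 1"
  shows "(gf_cubed has_real_derivative 4 * x ^ 3 * (arcsin x / sqrt (1 - x\<^sup>2))) (at x)"
proof -
  have pos: "1 - x\<^sup>2 > 0" using assms by (simp add: abs_square_less_1)
  define s where "s = sqrt (1 - x\<^sup>2)"
  have s: "s > 0" "s * s = 1 - x\<^sup>2" using pos by (auto simp: s_def)
  have "(gf_cubed has_real_derivative
      4 * (x\<^sup>2 / 3 + 2 / 3 - ((2 * x / 3 * s + (x\<^sup>2 + 2) / 3 * (- x / s)) * arcsin x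
        + (x\<^sup>2 + 2) / 3 * s * (1 / s)))) (at x)"
    unfolding gf_cubed_def s_def using assms pos
    by (auto intro!: derivative_eq_intros simp: field_simps)
  also have "4 * (x\<^sup>2 / 3 + 2 / 3 - ((2 * x / 3 * s + (x\<^sup>2 + 2) / 3 * (- x / s)) * arcsin x
        + (x\<^sup>2 + 2) / 3 * s * (1 / s)))
      = 4 * (x * (x\<^sup>2 + 2) - 2 * x * (s * s)) / 3 * (arcsin x / s)"
    using s(1) by (simp add: field_simps)
  also have "\<dots> = 4 * x ^ 3 * (arcsin x / s)"
    unfolding s(2) by (simp add: algebra_simps power2_eq_square power3_eq_cube)
  finally show ?thesis by (simp add: s_def)
qed

text \<open>The derivative of the difference is 4 x^3 / sqrt (1 - x^2) times the arcsine remainder.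
  The lower bound later supplies domination, the upper one convergence.\<close>

lemma gf_remainder_bounds:
  assumes "0 \<le> t" "t < 1"
  shows "0 \<le> gf_cubed t - t ^ 3 * gf_sum N t"
    and "gf_cubed t - t ^ 3 * gf_sum N t
           \<le> 4 * (cbinom_inv N * t ^ (2 * N) * arcsin t / sqrt (1 - t\<^sup>2)) * t"
proof -
  let ?u = "\<lambda>x. gf_cubed x - x ^ 3 * gf_sum N x"
  let ?e = "cbinom_inv N * t ^ (2 * N) * arcsin t / sqrt (1 - t\<^sup>2)"
  let ?d = "\<lambda>x. 4 * x ^ 3 * (arcsin x / sqrt (1 - x\<^sup>2)) - 4 * x ^ 3 * arcsin_sum N x"
  have u_deriv: "(?u has_real_derivative ?d x) (at x)" if "0 \<le> x" "x \<le> t" for x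
    using that assms by (intro DERIV_diff gf_cubed_deriv gf_sum_deriv) auto
  have d_bounds: "0 \<le> ?d x \<and> ?d x \<le> 4 * ?e" if x: "0 \<le> x" "x \<le> t" for x
  proof -
    have pos: "1 - t\<^sup>2 > 0" using assms by (simp add: abs_square_less_1)
    have xt: "x\<^sup>2 \<le> t\<^sup>2" using x by (simp add: power_mono)
    define s where "s = sqrt (1 - x\<^sup>2)"
    have s: "s > 0" "sqrt (1 - t\<^sup>2) \<le> s" using pos xt by (auto simp: s_def)
    define u where "u = arcsin x - s * arcsin_sum N x"
    have d: "?d x = 4 * x ^ 3 * (u / s)"
      using s(1) unfolding s_def[symmetric] u_def by (simp add: field_simps)
    have as: "0 \<le> arcsin x" "arcsin x \<le> arcsin t"
      using x assms by (auto intro: arcsin_le_arcsin simp: arcsin_nonneg)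
    have u: "0 \<le> u" "u \<le> cbinom_inv N * x ^ (2 * N) * arcsin x"
      unfolding u_def s_def using arcsin_remainder_bounds[of x N] x assms by auto
    have "u \<le> cbinom_inv N * t ^ (2 * N) * arcsin t"
      by (rule order.trans[OF u(2)], intro mult_mono power_mono)
         (use x as assms cbinom_inv_pos[of N] in auto)
    then have "u / s \<le> ?e"
      using s u pos by (intro frac_le) auto
    moreover have "x ^ 3 \<le> 1" using x assms by (intro power_le_one) auto
    ultimately have "x ^ 3 * (u / s) \<le> 1 * ?e"
      using u s x by (intro mult_mono) auto
    moreover have "0 \<le> x ^ 3 * (u / s)" using u s x by auto
    ultimately show ?thesis unfolding d by simp
  qed
  have "?u 0 \<le> ?u t"
    by (rule DERIV_nonneg_imp_nondecreasing[OF assms(1)]) (use u_deriv d_bounds in blast)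
  then show "0 \<le> ?u t" by (simp add: gf_cubed_def)
  \<comment> \<open>Since \<open>4 * ?e\<close> bounds the derivative uniformly on [0, t],
    comparison with a line of that slope suffices.\<close>
  have "4 * ?e * 0 - ?u 0 \<le> 4 * ?e * t - ?u t"
  proof (rule DERIV_nonneg_imp_nondecreasing[OF assms(1)])
    fix x assume x: "0 \<le> x" "x \<le> t"
    have "((\<lambda>x. 4 * ?e * x - ?u x) has_real_derivative 4 * ?e - ?d x) (at x)"
      by (rule DERIV_diff[OF _ u_deriv[OF x]]) (rule derivative_eq_intros refl | simp)+
    then show "\<exists>y. ((\<lambda>x. 4 * ?e * x - ?u x) has_real_derivative y) (at x) \<and> 0 \<le> y"
      using d_bounds[OF x] by (intro exI conjI) auto
  qed
  then show "?u t \<le> 4 * ?e * t" by (simp add: gf_cubed_def)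
qed

text \<open>The remainder lies between 0 and a constant multiple of (2N+1) t^(2N), which tends to
  0.\<close>

lemma gf_sum_tendsto:
  assumes "0 < t" "t < 1"
  shows "(\<lambda>N. gf_sum N t) \<longlonglongrightarrow> gf_cubed t / t ^ 3"
proof -
  define C where "C = 4 * (arcsin t / sqrt (1 - t\<^sup>2)) * t"
  have pos: "1 - t\<^sup>2 > 0" using assms by (simp add: abs_square_less_1)
  have C: "C \<ge> 0" using assms pos by (auto simp: C_def arcsin_nonneg)
  have "(\<lambda>N. gf_cubed t - t ^ 3 * gf_sum N t) \<longlonglongrightarrow> 0"
  proof (rule tendsto_sandwich)
    show "\<forall>\<^sub>F N in sequentially. 0 \<le> gf_cubed t - t ^ 3 * gf_sum N t"
      using gf_remainder_bounds(1)[of t] assms by auto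
    have "gf_cubed t - t ^ 3 * gf_sum N t \<le> (2 * real N + 1) * (t\<^sup>2) ^ N * C" for N
    proof -
      have "gf_cubed t - t ^ 3 * gf_sum N t \<le> cbinom_inv N * ((t\<^sup>2) ^ N * C)"
        using gf_remainder_bounds(2)[of t N] assms unfolding power_mult C_def by (simp add: mult_ac)
      also have "\<dots> \<le> (2 * real N + 1) * ((t\<^sup>2) ^ N * C)"
        by (intro mult_right_mono cbinom_inv_le mult_nonneg_nonneg C) auto
      finally show ?thesis by (simp add: mult_ac)
    qed
    then show "\<forall>\<^sub>F N in sequentially.
        gf_cubed t - t ^ 3 * gf_sum N t \<le> (2 * real N + 1) * (t\<^sup>2) ^ N * C" by auto
    have q: "norm (t\<^sup>2) < 1" using pos by simp
    have "(\<lambda>N. 2 * (of_nat N * (t\<^sup>2) ^ N) + (t\<^sup>2) ^ N) \<longlonglongrightarrow> 2 * 0 + 0"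
      by (intro tendsto_add tendsto_mult_left powser_times_n_limit_0 LIMSEQ_power_zero q)
    then have "(\<lambda>N. (2 * real N + 1) * (t\<^sup>2) ^ N) \<longlonglongrightarrow> 0"
      by (simp add: algebra_simps)
    then show "(\<lambda>N. (2 * real N + 1) * (t\<^sup>2) ^ N * C) \<longlonglongrightarrow> 0"
      by (rule tendsto_mult_left_zero)
  qed auto
  then have "(\<lambda>N. (gf_cubed t - (gf_cubed t - t ^ 3 * gf_sum N t)) / t ^ 3)
      \<longlonglongrightarrow> (gf_cubed t - 0) / t ^ 3"
    using assms by (intro tendsto_intros) auto
  then show ?thesis using assms by simp
qed

subsection \<open>The integrals \<open>scrF\<close>\<close>

lemma powr_half_shift:
  fixes t :: real
  assumes "t > 0"
  shows "t powr (real (s + k) - 1/2) = t powr (real s - 1/2) * t ^ k"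
proof -
  have "real (s + k) - 1/2 = (real s - 1/2) + real k" by simp
  then show ?thesis using assms by (simp only: powr_add powr_realpow)
qed

lemma powr_minus_half:
  fixes x :: real
  assumes "x \<ge> 0"
  shows "x powr (-1/2) = 1 / sqrt x"
proof -
  have "x powr (-1/2) = x powr (- (1/2))" by simp
  also have "\<dots> = inverse (sqrt x)"
    unfolding powr_minus powr_half_sqrt[OF assms] ..
  finally show ?thesis by (simp only: inverse_eq_divide)
qed

lemma sqrt_one_minus_square: "sqrt (1 - t\<^sup>2) = sqrt (1 + t) * sqrt (1 - t)"
  unfolding real_sqrt_mult[symmetric] by (simp add: algebra_simps power2_eq_square)

abbreviation scrF_integrand :: "nat \<Rightarrow> real \<Rightarrow> real" where
  "scrF_integrand s t \<equiv> t powr (real s - 1/2) * sqrt (1 + t) * arcsin t"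

lemma scrF_parts:
  "((\<lambda>t. (2 * real s + 4) * scrF_integrand (Suc s) t + (2 * real s + 1) * scrF_integrand s t)
     has_integral omega (Suc s)) {0..1}"
proof -
  \<comment> \<open>Taking the recurrence at index s + 1 makes the exponent positive, so
    \<open>?P\<close> is continuous with \<open>?P 0 = 0\<close>; \<open>?P 1\<close> is the term 2
    sqrt 2 pi of \<open>omega\<close>.\<close>
  let ?P = "\<lambda>t::real. 2 * (t powr (real s + 1/2) * (1 + t) * sqrt (1 + t) * arcsin t)"
  let ?f = "\<lambda>t. (2 * real s + 4) * scrF_integrand (Suc s) t + (2 * real s + 1) * scrF_integrand s t"
  let ?b = "\<lambda>m t::real. t powr (real m + 1/2) * (1 - t) powr (-1/2)"
  have "((\<lambda>t. ?f t + (2 * ?b s t + 2 * ?b (Suc s) t)) has_integral (?P 1 - ?P 0)) {0..1}"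
  \<comment> \<open>arcsin' is unbounded near 1, so differentiability is asked for only inside the
    interval.\<close>
  proof (rule fundamental_theorem_of_calculus_interior)
    show "continuous_on {0..1} ?P"
      by (intro continuous_intros continuous_on_powr') auto
    fix t :: real assume "t \<in> {0<..<1}"
    then have t: "0 < t" "t < 1" by auto
    define p q a where "p = t powr (real s - 1/2)" and "q = sqrt (1 + t)" and "a = sqrt (1 - t)"
    have q: "q > 0" "q * q = 1 + t" using t by (auto simp: q_def)
    have a: "a > 0" "a * a = 1 - t" using t by (auto simp: a_def)
    have sq: "sqrt (1 - t\<^sup>2) = q * a"
      unfolding q_def a_def by (rule sqrt_one_minus_square)
    have half: "real m + 1/2 = real (m + 1) - 1/2" for m by simp
    have pw: "t powr (real s + 1/2) = p * t" "t powr (real (Suc s) + 1/2) = p * t * t"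
        "t powr (real (Suc s) - 1/2) = p * t"
      unfolding half p_def
      using powr_half_shift[OF t(1), of s 1] powr_half_shift[OF t(1), of s 2]
      by (simp_all add: power2_eq_square mult.assoc)
    have aw: "(1 - t) powr (-1/2) = 1 / a"
      unfolding a_def using t by (intro powr_minus_half) simp
    have dp: "((\<lambda>t. t powr (real s + 1/2)) has_real_derivative (real s + 1/2) * p) (at t)"
      using has_real_derivative_powr[OF t(1), of "real s + 1/2"] by (simp add: p_def)
    have d1: "((\<lambda>t. 1 + t) has_real_derivative 1) (at t)"
      by (rule derivative_eq_intros refl | simp)+
    have dq: "((\<lambda>t. sqrt (1 + t)) has_real_derivative 1 / (2 * q)) (at t)"
      unfolding q_def using t by (auto intro!: derivative_eq_intros simp: field_simps)
    have da: "(arcsin has_real_derivative 1 / (q * a)) (at t)"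
      unfolding sq[symmetric] using DERIV_arcsin[of t] t by (simp add: divide_inverse)
    have "(?P has_real_derivative
        2 * ((((real s + 1/2) * p * (1 + t) + p * t) * q + p * t * (1 + t) * (1 / (2 * q))) * arcsin t
          + p * t * (1 + t) * q * (1 / (q * a)))) (at t)"
      by (rule DERIV_cong[OF DERIV_cmult[OF DERIV_mult[OF DERIV_mult[OF DERIV_mult[OF dp d1] dq] da]]])
         (simp add: pw q_def[symmetric] algebra_simps)
    also have "p * t * (1 + t) * (1 / (2 * q)) = p * t * q / 2"
      unfolding q(2)[symmetric] using q(1) by (simp add: field_simps)
    also have "p * t * (1 + t) * q * (1 / (q * a)) = p * t * (1 + t) / a"
      using q(1) by simp
    also have "2 * ((((real s + 1/2) * p * (1 + t) + p * t) * q + p * t * q / 2) * arcsin t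
          + p * t * (1 + t) / a) = ?f t + (2 * ?b s t + 2 * ?b (Suc s) t)"
      unfolding pw aw p_def[symmetric] q_def[symmetric] using a(1) by (simp add: field_simps)
    finally show "(?P has_vector_derivative ?f t + (2 * ?b s t + 2 * ?b (Suc s) t)) (at t)"
      by (simp add: has_real_derivative_iff_has_vector_derivative)
  qed auto
  moreover have b: "(?b m has_integral Beta (real m + 3/2) (1/2)) {0..1}" for m
    using has_integral_Beta_real[of "real m + 3/2" "1/2"] by (simp add: add.commute)
  have "((\<lambda>t. 2 * ?b s t + 2 * ?b (Suc s) t) has_integral
      2 * Beta (real s + 3/2) (1/2) + 2 * Beta (real (Suc s) + 3/2) (1/2)) {0..1}"
    by (rule has_integral_add[OF has_integral_mult_right[OF b] has_integral_mult_right[OF b]])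
  \<comment> \<open>Subtracting the two Beta integrals yields integrability of \<open>?f\<close>
    together with its integral.\<close>
  ultimately have "((\<lambda>t. ?f t + (2 * ?b s t + 2 * ?b (Suc s) t) - (2 * ?b s t + 2 * ?b (Suc s) t))
     has_integral (?P 1 - ?P 0 - (2 * Beta (real s + 3/2) (1/2) + 2 * Beta (real (Suc s) + 3/2) (1/2))))
     {0..1}"
    by (rule has_integral_diff)
  moreover have "?P 1 - ?P 0 - (2 * Beta (real s + 3/2) (1/2) + 2 * Beta (real (Suc s) + 3/2) (1/2))
      = omega (Suc s)"
    by (simp add: omega_def add_ac)
  ultimately show ?thesis by simp
qed

text \<open>For positive index the integrand is visibly continuous. At index 0 the exponent is -1/2,
  and integrability is extracted from \<open>scrF_parts\<close> by subtracting the index 1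
  integrand.\<close>

lemma scrF_integrand_integrable: "scrF_integrand s integrable_on {0..1}"
proof -
  have Suc: "scrF_integrand (Suc s) integrable_on {0..1}" for s
    by (intro integrable_continuous_real continuous_intros continuous_on_powr') auto
  show ?thesis
  proof (cases s)
    case 0
    have "(\<lambda>t. 4 * scrF_integrand (Suc 0) t + scrF_integrand 0 t) integrable_on {0..1}"
      using has_integral_integrable[OF scrF_parts[of 0]] by simp
    then have "(\<lambda>t. 4 * scrF_integrand (Suc 0) t + scrF_integrand 0 t - 4 * scrF_integrand (Suc 0) t)
        integrable_on {0..1}"
      using Suc[of 0] by (intro integrable_diff integrable_on_mult_right)
    then show ?thesis using 0 by simp
  qed (use Suc in simp)
qed

lemma scrF_has_integral: "(scrF_integrand s has_integral scrF s) {0..1}"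
  unfolding scrF_def by (rule integrable_integral[OF scrF_integrand_integrable])

lemma scrF_rec: "(2 * real s + 4) * scrF (Suc s) + (2 * real s + 1) * scrF s = omega (Suc s)"
  by (rule has_integral_unique[OF _ scrF_parts])
     (intro has_integral_add has_integral_mult_right scrF_has_integral)

text \<open>The product \<open>(-1) ^ s * cbinom_inv s * (real s + 1)\<close> is a summation factor:
  multiplied by it, \<open>scrF_rec\<close> telescopes with increments
  \<open>1/2 * (-1) ^ k * cbinom_inv k * omega k\<close>.\<close>

lemma scrF_closed_form:
  "scrF s = (-1) ^ s / 4 ^ s * (real ((2 * s) choose s) / (real s + 1)) *
     (scrF 0 + 1/2 * (\<Sum>k=1..s. (-1) ^ k * 4 ^ k / real ((2 * k) choose k) * omega k))"
proof -
  have "scrF s * ((-1) ^ s * cbinom_inv s * (real s + 1))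
      = scrF 0 + 1/2 * (\<Sum>k=1..s. (-1) ^ k * cbinom_inv k * omega k)"
  proof (induction s)
    case 0
    show ?case by (simp add: cbinom_inv_def)
  next
    case (Suc s)
    have "scrF 0 + 1/2 * (\<Sum>k=1..Suc s. (-1) ^ k * cbinom_inv k * omega k)
        = scrF s * ((-1) ^ s * cbinom_inv s * (real s + 1))
          - 1/2 * (-1) ^ s * cbinom_inv (Suc s) * omega (Suc s)"
      unfolding Suc.IH by (simp add: algebra_simps)
    also have "\<dots> = scrF (Suc s) * ((-1) ^ Suc s * cbinom_inv (Suc s) * (real (Suc s) + 1))"
      unfolding scrF_rec[symmetric] cbinom_inv_Suc by (simp add: field_simps)
    finally show ?case by simp
  qed
  moreover have "(-1) ^ s * cbinom_inv s * (real s + 1) \<noteq> 0"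
    using cbinom_inv_pos[of s] by simp
  ultimately have "scrF s = (scrF 0 + 1/2 * (\<Sum>k=1..s. (-1) ^ k * cbinom_inv k * omega k))
      / ((-1) ^ s * cbinom_inv s * (real s + 1))"
    by (simp add: field_simps)
  also have "\<dots> = (-1) ^ s / 4 ^ s * (real ((2 * s) choose s) / (real s + 1)) *
      (scrF 0 + 1/2 * (\<Sum>k=1..s. (-1) ^ k * cbinom_inv k * omega k))"
    by (cases "even s") (simp_all add: cbinom_inv_def field_simps)
  finally show ?thesis by (simp add: cbinom_inv_def)
qed

subsection \<open>Integrating the generating function\<close>

text \<open>The series of the theorem for r = q + 3, scaled by pi / 4^r. The Beta integrals turn its
  terms into integrals against one weight, and sum and integral are exchanged.\<close>

lemma central_binomial_series_sums:
  "(\<lambda>m. cbinom_inv (Suc m) / (real (Suc m) * (real (Suc m) + 3/2)) * (pi / cbinom_inv (2 * Suc m + (q + 3))))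
     sums (4/9 * (pi / cbinom_inv (q + 3)) + 8/3 * (pi / cbinom_inv (q + 1))
           - 4/3 * scrF (q + 2) - 8/3 * scrF q)"
proof -
  let ?w = "\<lambda>m t::real. t powr (real m - 1/2) * (1 - t) powr (-1/2)"
  let ?c = "\<lambda>m. cbinom_inv (Suc m) / (real (Suc m) * (real (Suc m) + 3/2))"
  let ?f = "\<lambda>N t. \<Sum>m<N. ?c m * ?w (2 * Suc m + (q + 3)) t"
  \<comment> \<open>This is \<open>?w (q + 3) t * (gf_cubed t / t ^ 3)\<close> expanded: (1 -
    t)^(-1/2) cancels against sqrt (1 - t^2), leaving the sqrt (1 + t) of
    \<open>scrF\<close>.\<close>
  let ?g = "\<lambda>t. 4/9 * ?w (q + 3) t + 8/3 * ?w (q + 1) t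
              - 4/3 * scrF_integrand (q + 2) t - 8/3 * scrF_integrand q t"
  let ?I = "4/9 * (pi / cbinom_inv (q + 3)) + 8/3 * (pi / cbinom_inv (q + 1))
           - 4/3 * scrF (q + 2) - 8/3 * scrF q"
  let ?J = "\<lambda>N. \<Sum>m<N. ?c m * (pi / cbinom_inv (2 * Suc m + (q + 3)))"
  \<comment> \<open>The open interval keeps the pointwise identities away from the division by t^3
    at 0 and from the singularity at 1.\<close>
  have g: "(?g has_integral ?I) {0<..<1}"
    unfolding has_integral_Icc_iff_Ioo[symmetric]
    by (intro has_integral_add has_integral_diff has_integral_mult_right
          Beta_nat_half_has_integral scrF_has_integral)
  have f: "(?f N has_integral ?J N) {0<..<1}" for N
    unfolding has_integral_Icc_iff_Ioo[symmetric]
    by (intro has_integral_sum has_integral_mult_right Beta_nat_half_has_integral) auto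
  have f_eq: "?f N t = ?w (q + 3) t * gf_sum N t" if t: "0 < t" "t < 1" for N t
  proof -
    have w: "?w (2 * Suc m + (q + 3)) t = ?w (q + 3) t * t ^ (2 * Suc m)" for m
      using powr_half_shift[OF t(1), of "q + 3" "2 * Suc m"] by (simp only: mult_ac add_ac)
    show ?thesis
      unfolding w gf_sum_def sum_distrib_left by (simp only: mult_ac)
  qed
  have g_eq: "?g t = ?w (q + 3) t * (gf_cubed t / t ^ 3)" if t: "0 < t" "t < 1" for t
  proof -
    define p a b where "p = t powr (real q - 1/2)" and "a = sqrt (1 - t)" and "b = sqrt (1 + t)"
    have a: "a > 0" using t by (simp add: a_def)
    have sq: "sqrt (1 - t\<^sup>2) = b * a"
      unfolding b_def a_def by (rule sqrt_one_minus_square)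
    have aw: "(1 - t) powr (-1/2) = 1 / a"
      unfolding a_def using t by (intro powr_minus_half) simp
    have pw: "t powr (real (q + k) - 1/2) = p * t ^ k" for k
      unfolding p_def by (rule powr_half_shift[OF t(1)])
    show ?thesis
      unfolding pw aw gf_cubed_def sq p_def[symmetric] b_def[symmetric] using a t
      by (simp add: field_simps power2_eq_square power3_eq_cube)
  qed
  have "(\<lambda>N. integral {0<..<1} (?f N)) \<longlonglongrightarrow> integral {0<..<1} ?g"
  \<comment> \<open>All terms are nonnegative, so the limit \<open>?g\<close> itself dominates the
    partial sums.\<close>
  proof (rule dominated_convergence(2))
    show "?f N integrable_on {0<..<1}" for N using f by blast
    show "?g integrable_on {0<..<1}" using g by blast
    fix t :: real assume "t \<in> {0<..<1}"
    then have t: "0 < t" "t < 1" by auto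
    show "norm (?f N t) \<le> ?g t" for N
    proof -
      have "0 \<le> gf_sum N t"
        unfolding gf_sum_def using t cbinom_inv_pos
        by (intro sum_nonneg mult_nonneg_nonneg divide_nonneg_nonneg) (auto intro: less_imp_le)
      moreover have "gf_sum N t \<le> gf_cubed t / t ^ 3"
        using gf_remainder_bounds(1)[of t N] t by (simp add: field_simps)
      ultimately show ?thesis
        unfolding f_eq[OF t] g_eq[OF t] real_norm_def abs_mult
        by (intro mult_mono) (simp_all add: abs_mult)
    qed
    show "(\<lambda>N. ?f N t) \<longlonglongrightarrow> ?g t"
      unfolding f_eq[OF t] g_eq[OF t] by (intro tendsto_mult_left gf_sum_tendsto t)
  qed
  then show ?thesis
    unfolding sums_def using integral_unique[OF f] integral_unique[OF g] by simp
qed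

theorem theorem6p0p1:
  fixes r :: nat
  assumes "r \<ge> 3"
  shows "(\<lambda>m. (let n = m + 1 in
            1 / (4 ^ n * real n * (real n + 3/2)) *
            (real ((4 * n + 2 * r) choose (2 * n + r)) / real ((2 * n) choose n))))
         sums (4/9 * real ((2 * r) choose r) + 128/3 * real ((2 * r - 4) choose (r - 2))
               - 4 ^ (r + 1) / (3 * pi) * scrF (r - 1)
               - 2 * 4 ^ (r + 1) / (3 * pi) * scrF (r - 3))
       \<and> (\<forall>s::nat. scrF s =
            (-1) ^ s / 4 ^ s * (real ((2 * s) choose s) / (real s + 1)) *
            (scrF 0 + 1/2 * (\<Sum>k=1..s. (-1) ^ k * 4 ^ k / real ((2 * k) choose k) * omega k)))"
proof (intro conjI allI)
  \<comment> \<open>Writing r this way removes every truncated subtraction.\<close>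
  obtain q where r: "r = q + 3" using assms by (metis le_add_diff_inverse2)
  have inv: "real ((2 * n) choose n) = 4 ^ n / cbinom_inv n" for n
    by (simp add: cbinom_inv_def)
  let ?t = "\<lambda>m. cbinom_inv (Suc m) / (real (Suc m) * (real (Suc m) + 3/2))
      * (pi / cbinom_inv (2 * Suc m + (q + 3)))"
  let ?I = "4/9 * (pi / cbinom_inv (q + 3)) + 8/3 * (pi / cbinom_inv (q + 1))
           - 4/3 * scrF (q + 2) - 8/3 * scrF q"
  have "(\<lambda>m. 4 ^ r / pi * ?t m) sums (4 ^ r / pi * ?I)"
    by (intro sums_mult central_binomial_series_sums)
  moreover have "4 ^ r / pi * ?t m = (let n = m + 1 in
            1 / (4 ^ n * real n * (real n + 3/2)) *
            (real ((4 * n + 2 * r) choose (2 * n + r)) / real ((2 * n) choose n)))" for m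
  proof -
    define n where "n = Suc m"
    have "real ((4 * n + 2 * r) choose (2 * n + r)) = 4 ^ (2 * n + r) / cbinom_inv (2 * n + r)"
      using inv[of "2 * n + r"] by (simp add: algebra_simps)
    then have "1 / (4 ^ n * real n * (real n + 3/2)) *
            (real ((4 * n + 2 * r) choose (2 * n + r)) / real ((2 * n) choose n))
       = 4 ^ r * (cbinom_inv n / (real n * (real n + 3/2)) / cbinom_inv (2 * n + r))"
      unfolding inv[of n]
      by (simp add: power_add power_mult_distrib power_mult power2_eq_square mult_ac)
    then show ?thesis by (simp add: Let_def n_def r del: mult_Suc_right)
  qed
  moreover have "4 ^ r / pi * ?I = 4/9 * real ((2 * r) choose r) + 128/3 * real ((2 * r - 4) choose (r - 2))
               - 4 ^ (r + 1) / (3 * pi) * scrF (r - 1)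
               - 2 * 4 ^ (r + 1) / (3 * pi) * scrF (r - 3)"
  proof -
    have e: "2 * r - 4 = 2 * (q + 1)" "r - 2 = q + 1" "r - 1 = q + 2" "r - 3 = q"
      by (auto simp: r)
    show ?thesis
      \<comment> \<open>The constant 128/3 is 8/3 times 4^2, as 4^r /
        \<open>cbinom_inv (q + 1)\<close> is 4^2 times the binomial coefficient.\<close>
      unfolding e inv unfolding r by (simp add: field_simps power_add)
  qed
  ultimately show "(\<lambda>m. (let n = m + 1 in
            1 / (4 ^ n * real n * (real n + 3/2)) *
            (real ((4 * n + 2 * r) choose (2 * n + r)) / real ((2 * n) choose n))))
         sums (4/9 * real ((2 * r) choose r) + 128/3 * real ((2 * r - 4) choose (r - 2))
               - 4 ^ (r + 1) / (3 * pi) * scrF (r - 1)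
               - 2 * 4 ^ (r + 1) / (3 * pi) * scrF (r - 3))"
    by simp
qed (rule scrF_closed_form)

end
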